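(* Let $\beta$ be a complex number and let $n\ge 1$ be an integer. For integers $m\ge 0$ put $c_{n,m}=[x^n]\,{}_{(\beta)}a^{m}(x)$, and define ${}_{(\beta)}\varphi_n(x)=(1-x)^{2n+1}\sum_{m\ge 0}[m+1]_n\,c_{n,m}\,x^m$, where $[m+1]_n=(m+1)(m+2)\cdots(m+n)$. Then $${}_{(\beta)}\varphi_n(x)=\frac{(n+1)!}{n}\sum_{m=0}^{n}\binom{n(2-\beta)}{m-1}\binom{n\beta}{n-m}x^m .$$
   Context: For complex $y$ and integer $k$, $\binom{y}{k}=y(y-1)\cdots(y-k+1)/k!$ if $k\ge 0$ and $\binom{y}{k}=0$ if $k<0$. The generalized binomial series ${}_{(\beta)}a(x)$ is the formal power series whose powers are ${}_{(\beta)}a^{\varphi}(x)=\sum_{k\ge0}\frac{\varphi}{\varphi+k\beta}\binom{\varphi+k\beta}{k}x^k$ for every $\varphi$; here the coefficient of $x^k$ for $k\ge1$ is to be read as the polynomial $\frac{\varphi}{k}\binom{\varphi+k\beta-1}{k-1}$ in $\varphi,\beta$, and the coefficient of $x^0$ is $1$. Equivalently, $\sum_{m}[m+1]_n c_{n,m}x^m$ is the generating function of the $n$-th descending diagonal of the exponential Riordan matrix $|e^x|^{-1}(1,x\,{}_{(\beta)}a(x))|e^x|$, whose $(i,j)$ entry is $\frac{i!}{j!}[x^i](x\,{}_{(\beta)}a(x))^j$. *)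

theory Defs
  imports "HOL-Computational_Algebra.Computational_Algebra" Complex_Main
begin

text \<open>The library's \<open>gchoose\<close> only takes a natural lower index; here negative ones occur.\<close>

definition int_gbinomial :: "complex \<Rightarrow> int \<Rightarrow> complex" where
  "int_gbinomial y k = (if k < 0 then 0 else y gchoose nat k)"

text \<open>
  The coefficient of \<open>x\<^sup>k\<close>, \<open>k \<ge> 1\<close>, is the polynomial reading of
  \<open>\<phi> / (\<phi> + k \<beta>) * (\<phi> + k \<beta> gchoose k)\<close>, so no exception is needed
  where \<open>\<phi> + k \<beta> = 0\<close>.
\<close>

definition gbs_power :: "complex \<Rightarrow> complex \<Rightarrow> complex fps" where
  "gbs_power \<beta> \<phi> = Abs_fps (\<lambda>k. if k = 0 then 1
     else \<phi> / of_nat k * ((\<phi> + of_nat k * \<beta> - 1) gchoose (k - 1)))"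

definition gen_binomial_series :: "complex \<Rightarrow> complex fps" where
  "gen_binomial_series \<beta> = gbs_power \<beta> 1"

definition gbs_coeff :: "complex \<Rightarrow> nat \<Rightarrow> nat \<Rightarrow> complex" where
  "gbs_coeff \<beta> n m = fps_nth (gen_binomial_series \<beta> ^ m) n"

definition gbs_phi :: "complex \<Rightarrow> nat \<Rightarrow> complex fps" where
  "gbs_phi \<beta> n = (1 - fps_X) ^ (2 * n + 1) *
     Abs_fps (\<lambda>m. pochhammer (of_nat (m + 1)) n * gbs_coeff \<beta> n m)"

text \<open>
  Consistency of the definitions: \<open>gbs_power \<beta> \<phi>\<close> really is multiplicative in \<open>\<phi>\<close>
  (the Rothe-Hagen identity), so the \<open>m\<close>-th power of the series in the ring of formal
  power series is the one given by the explicit formula.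
\<close>

lemma gbs_power_diff:
  "fps_nth (gbs_power \<beta> \<phi>) (Suc n) - fps_nth (gbs_power \<beta> (\<phi> - 1)) (Suc n)
     = fps_nth (gbs_power \<beta> (\<phi> + \<beta> - 1)) n"
proof (cases n)
  case 0
  then show ?thesis by (simp add: gbs_power_def)
next
  case (Suc j)
  define y where "y = \<phi> + of_nat (Suc (Suc j)) * \<beta> - 2"
  define N :: complex where "N = of_nat j"
  define b where "b = (y gchoose j)"
  define c where "c = (y gchoose Suc j)"
  have N: "N + 1 \<noteq> 0" "N + 2 \<noteq> 0"
    unfolding N_def using of_nat_neq_0[of j, where 'a=complex] of_nat_neq_0[of "Suc j", where 'a=complex]
    by (simp_all add: add_ac)
  have c: "(N + 1) * c = (y - N) * b"
    unfolding b_def c_def N_def using gbinomial_absorb_comp[of y j] gbinomial_absorption[of j y]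
    by (simp add: algebra_simps gbinomial_mult_1)
  have p: "((y + 1) gchoose Suc j) = b + c"
    unfolding b_def c_def by (rule gbinomial_Suc_Suc)
  have y: "y = \<phi> + (N + 2) * \<beta> - 2"
    by (simp add: y_def N_def algebra_simps)
  have e: "fps_nth (gbs_power \<beta> \<phi>) (Suc n) = \<phi> / (N + 2) * (b + c)"
    unfolding p[symmetric] by (simp add: gbs_power_def Suc N_def y_def algebra_simps)
  have e2: "fps_nth (gbs_power \<beta> (\<phi> - 1)) (Suc n) = (\<phi> - 1) / (N + 2) * c"
    by (simp add: gbs_power_def Suc N_def y_def c_def algebra_simps)
  have e3: "fps_nth (gbs_power \<beta> (\<phi> + \<beta> - 1)) n = (\<phi> + \<beta> - 1) / (N + 1) * b"
    by (simp add: gbs_power_def Suc N_def y_def b_def algebra_simps)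
  have "c = (y - N) * b / (N + 1)" using c N by (simp add: field_simps)
  then have "\<phi> / (N + 2) * (b + c) - (\<phi> - 1) / (N + 2) * c = (\<phi> + \<beta> - 1) / (N + 1) * b"
    using N unfolding y by (simp add: divide_simps) (simp add: algebra_simps)
  then show ?thesis by (simp only: e e2 e3)
qed

lemma gbs_power_nth_poly: "\<exists>p. \<forall>\<phi>. fps_nth (gbs_power \<beta> (\<phi> + d)) k = poly p \<phi>"
proof (cases "k = 0")
  case True
  then show ?thesis by (intro exI[of _ 1]) (simp add: gbs_power_def)
next
  case False
  then show ?thesis
    by (intro exI[of _ "smult (1 / (of_nat k * fact (k - 1))) ([:d, 1:] *
          (\<Prod>i = 0..<k - 1. [:d + of_nat k * \<beta> - 1 - of_nat i, 1:]))"])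
       (simp add: gbs_power_def gbinomial_prod_rev poly_prod algebra_simps add_divide_distrib)
qed

lemma gbs_power_add: "gbs_power \<beta> (\<phi> + \<psi>) = gbs_power \<beta> \<phi> * gbs_power \<beta> \<psi>"
proof -
  have "fps_nth (gbs_power \<beta> \<phi> * gbs_power \<beta> \<psi>) n = fps_nth (gbs_power \<beta> (\<phi> + \<psi>)) n"
    for n and \<phi> :: complex
  proof (induction n arbitrary: \<phi>)
    case 0
    then show ?case by (simp add: gbs_power_def)
  next
    case (Suc n)
    let ?F = "\<lambda>\<phi>. fps_nth (gbs_power \<beta> \<phi> * gbs_power \<beta> \<psi>) (Suc n)"
    let ?G = "\<lambda>\<phi>. fps_nth (gbs_power \<beta> (\<phi> + \<psi>)) (Suc n)"
    have step: "?F \<phi> - ?F (\<phi> - 1) = ?G \<phi> - ?G (\<phi> - 1)" for \<phi>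
    proof -
      have "?F \<phi> - ?F (\<phi> - 1) = fps_nth ((gbs_power \<beta> \<phi> - gbs_power \<beta> (\<phi> - 1)) * gbs_power \<beta> \<psi>) (Suc n)"
        by (simp add: algebra_simps)
      also have "gbs_power \<beta> \<phi> - gbs_power \<beta> (\<phi> - 1) = fps_X * gbs_power \<beta> (\<phi> + \<beta> - 1)"
      proof (rule fps_ext)
        show "fps_nth (gbs_power \<beta> \<phi> - gbs_power \<beta> (\<phi> - 1)) k
            = fps_nth (fps_X * gbs_power \<beta> (\<phi> + \<beta> - 1)) k" for k
        proof (cases k)
          case 0
          then show ?thesis by (simp add: gbs_power_def)
        next
          case (Suc j)
          then show ?thesis using gbs_power_diff[of \<beta> \<phi> j] by simp
        qed
      qed
      also have "fps_nth (fps_X * gbs_power \<beta> (\<phi> + \<beta> - 1) * gbs_power \<beta> \<psi>) (Suc n)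
          = fps_nth (gbs_power \<beta> (\<phi> + \<beta> - 1 + \<psi>)) n"
        using Suc.IH by (simp add: mult.assoc)
      also have "\<dots> = ?G \<phi> - ?G (\<phi> - 1)"
        using gbs_power_diff[of \<beta> "\<phi> + \<psi>" n] by (simp add: algebra_simps)
      finally show ?thesis .
    qed
    have zero: "gbs_power \<beta> 0 = 1"
      by (rule fps_ext) (simp add: gbs_power_def)
    have nat_eq: "?F (of_nat j) = ?G (of_nat j)" for j
    proof (induction j)
      case 0
      then show ?case by (simp add: zero)
    next
      case (Suc j)
      then show ?case using step[of "of_nat (Suc j)"] by simp
    qed
    obtain q where q: "\<And>k \<phi>. fps_nth (gbs_power \<beta> \<phi>) k = poly (q k) \<phi>"
      using gbs_power_nth_poly[of \<beta> 0] by simp metis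
    obtain r where r: "\<And>\<phi>. ?G \<phi> = poly r \<phi>"
      using gbs_power_nth_poly[of \<beta> \<psi>] by metis
    define p where "p = (\<Sum>i=0..Suc n. smult (fps_nth (gbs_power \<beta> \<psi>) (Suc n - i)) (q i)) - r"
    have p: "poly p \<phi> = ?F \<phi> - ?G \<phi>" for \<phi>
      unfolding p_def r fps_mult_nth by (simp add: poly_sum q mult.commute)
    have "range of_nat \<subseteq> {x. poly p x = 0}"
      using nat_eq by (auto simp: p)
    moreover have "infinite (range (of_nat :: nat \<Rightarrow> complex))"
      by (rule range_inj_infinite) (rule inj_of_nat)
    ultimately have "p = 0"
      using poly_roots_finite finite_subset by blast
    then show ?case using p[of \<phi>] by simp
  qed
  then show ?thesis by (simp add: fps_eq_iff)
qed

lemma gen_binomial_series_power: "gen_binomial_series \<beta> ^ m = gbs_power \<beta> (of_nat m)"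
proof (induction m)
  case 0
  show ?case by (rule fps_ext) (simp add: gbs_power_def)
next
  case (Suc m)
  then show ?case by (simp add: gen_binomial_series_def gbs_power_add)
qed

end

theory Submission imports Defs begin

text \<open>
  Since \<open>[m+1]\<^sub>n \<cdot> m = (n+1)! \<cdot> C(m+n, n+1)\<close>, the coefficients of the diagonal series are
  \<open>(n+1)!/n\<close> times \<open>C(m+n, n+1) \<cdot> C(m+n\<beta>-1, n-1)\<close>. Nanjundiah's identity expands such a
  product in the shifts \<open>C(m-j+2n, 2n)\<close> of the coefficients of \<open>1/(1-x)^(2n+1)\<close>, and the
  expansion coefficients are those of the claimed numerator polynomial.
\<close>

text \<open>Trinomial revision turns \<open>(a gchoose k) * (of_nat k gchoose j)\<close> into
  \<open>(a gchoose j) * ((a - of_nat j) gchoose (k - j))\<close>; what remains is a Vandermonde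
  convolution in \<open>k - j\<close>.\<close>

lemma gbinomial_Vandermonde_shift:
  fixes a b :: "'a::field_char_0"
  assumes "j \<le> n"
  shows "(\<Sum>k=0..n. (a gchoose k) * (of_nat k gchoose j) * (b gchoose (n - k)))
       = (a gchoose j) * ((a - of_nat j + b) gchoose (n - j))"
proof -
  have "(\<Sum>k=0..n. (a gchoose k) * (of_nat k gchoose j) * (b gchoose (n - k)))
      = (\<Sum>k=j..n. (a gchoose k) * (of_nat k gchoose j) * (b gchoose (n - k)))"
    by (rule sum.mono_neutral_right) (auto simp: binomial_gbinomial[symmetric] binomial_eq_0)
  also have "\<dots> = (\<Sum>k=j..n. (a gchoose j) * ((a - of_nat j) gchoose (k - j)) * (b gchoose (n - k)))"
    by (intro sum.cong refl) (simp add: gbinomial_trinomial_revision)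
  also have "\<dots> = (\<Sum>i=0..n - j. (a gchoose j) * ((a - of_nat j) gchoose i) * (b gchoose (n - j - i)))"
    by (rule sum.reindex_bij_witness[of _ "\<lambda>i. i + j" "\<lambda>k. k - j"]) (use assms in auto)
  also have "\<dots> = (a gchoose j) * ((a - of_nat j + b) gchoose (n - j))"
    by (simp only: gbinomial_Vandermonde sum_distrib_left[symmetric] mult.assoc)
  finally show ?thesis .
qed

text \<open>Vandermonde expands the last factor in the \<open>of_nat k gchoose j\<close>. After the
  sums are swapped, the shifted convolution evaluates the sum over \<open>k\<close>, and a second
  Vandermonde convolution evaluates the sum over \<open>j\<close>.\<close>

lemma gbinomial_Nanjundiah:
  fixes x y :: "'a::field_char_0"
  shows "(\<Sum>k=0..n. ((of_nat m - x + y) gchoose k) * ((of_nat n + x - y) gchoose (n - k))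
            * ((x + of_nat k) gchoose (m + n)))
       = (x gchoose m) * (y gchoose n)"
proof -
  define a where "a = of_nat m - x + y"
  define b where "b = of_nat n + x - y"
  have expand: "((x + of_nat k) gchoose (m + n))
      = (\<Sum>j=0..n. (of_nat k gchoose j) * (x gchoose (m + n - j)))" if "k \<le> n" for k
  proof -
    have "((x + of_nat k) gchoose (m + n))
        = (\<Sum>j=0..m + n. (of_nat k gchoose j) * (x gchoose (m + n - j)))"
      by (simp add: gbinomial_Vandermonde add.commute)
    \<comment> \<open>Cutting at \<open>n\<close> gives a range independent of \<open>k\<close>, so
      that the sums can be swapped; the dropped terms have \<open>j > k\<close>.\<close>
    also have "\<dots> = (\<Sum>j=0..n. (of_nat k gchoose j) * (x gchoose (m + n - j)))"
      using that by (intro sum.mono_neutral_right) (auto simp: binomial_gbinomial[symmetric] binomial_eq_0)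
    finally show ?thesis .
  qed
  have "(\<Sum>k=0..n. (a gchoose k) * (b gchoose (n - k)) * ((x + of_nat k) gchoose (m + n)))
      = (\<Sum>k=0..n. \<Sum>j=0..n. (x gchoose (m + n - j))
           * ((a gchoose k) * (of_nat k gchoose j) * (b gchoose (n - k))))"
    by (intro sum.cong refl) (simp add: expand sum_distrib_left mult_ac)
  also have "\<dots> = (\<Sum>j=0..n. (x gchoose (m + n - j))
           * (\<Sum>k=0..n. (a gchoose k) * (of_nat k gchoose j) * (b gchoose (n - k))))"
    by (subst sum.swap) (simp add: sum_distrib_left)
  also have "\<dots> = (\<Sum>j=0..n. (x gchoose m) * ((a gchoose j) * ((x - of_nat m) gchoose (n - j))))"
  proof (intro sum.cong refl)
    fix j assume "j \<in> {0..n}"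
    then have j: "j \<le> n" by simp
    \<comment> \<open>Since \<open>a + b\<close> equals \<open>m + n\<close>, the upper index is a
      natural number. Binomial symmetry therefore applies and prepares a second trinomial revision,
      which splits off \<open>x gchoose m\<close>.\<close>
    have "a - of_nat j + b = of_nat (m + n - j)"
      using j by (simp add: a_def b_def of_nat_diff)
    moreover have "(x gchoose (m + n - j)) * (of_nat (m + n - j) gchoose (n - j))
        = (x gchoose m) * ((x - of_nat m) gchoose (n - j))"
    proof -
      have "(of_nat (m + n - j) gchoose (n - j)) = (of_nat (m + n - j) gchoose m :: 'a)"
        unfolding binomial_gbinomial[symmetric] using j
        by (subst binomial_symmetric) auto
      then show ?thesis
        using gbinomial_trinomial_revision[of m "m + n - j" x] j by simp
    qed
    ultimately show "(x gchoose (m + n - j))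
           * (\<Sum>k=0..n. (a gchoose k) * (of_nat k gchoose j) * (b gchoose (n - k)))
        = (x gchoose m) * ((a gchoose j) * ((x - of_nat m) gchoose (n - j)))"
      using gbinomial_Vandermonde_shift[OF j, of a b] by (simp add: mult_ac)
  qed
  also have "\<dots> = (x gchoose m) * ((a + (x - of_nat m)) gchoose n)"
    by (simp only: gbinomial_Vandermonde sum_distrib_left[symmetric])
  also have "a + (x - of_nat m) = y"
    by (simp add: a_def)
  finally show ?thesis
    by (simp add: a_def b_def)
qed

lemma diagonal_coeff:
  assumes "n \<ge> 1"
  shows "pochhammer (of_nat (k + 1)) n * gbs_coeff \<beta> n k = fact (n + 1) / of_nat n
    * ((of_nat (k + n) gchoose (n + 1)) * ((of_nat k + of_nat n * \<beta> - 1) gchoose (n - 1)))"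
proof -
  have "fact (n + 1) * (of_nat (k + n) gchoose (n + 1)) = pochhammer (of_nat k :: complex) (n + 1)"
    by (simp add: gbinomial_pochhammer' del: fact_Suc)
  also have "\<dots> = of_nat k * pochhammer (of_nat (k + 1)) n"
    by (simp add: pochhammer_rec add.commute)
  finally have poch: "fact (n + 1) * (of_nat (k + n) gchoose (n + 1))
      = of_nat k * pochhammer (of_nat (k + 1) :: complex) n" .
  \<comment> \<open>By the power law the \<open>k\<close>-th power is explicit;
    \<open>n \<ge> 1\<close> selects its non-constant coefficients, whose factor \<open>k\<close>
    completes the rising factorial.\<close>
  have "gbs_coeff \<beta> n k
      = of_nat k / of_nat n * ((of_nat k + of_nat n * \<beta> - 1) gchoose (n - 1))"
    using assms by (simp add: gbs_coeff_def gen_binomial_series_power gbs_power_def)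
  then have "pochhammer (of_nat (k + 1)) n * gbs_coeff \<beta> n k
      = (of_nat k * pochhammer (of_nat (k + 1)) n) / of_nat n
        * ((of_nat k + of_nat n * \<beta> - 1) gchoose (n - 1))"
    by simp
  then show ?thesis
    unfolding poch[symmetric] by simp
qed

lemma diagonal_coeff_expansion:
  assumes "n \<ge> 1"
  shows "(of_nat (k + n) gchoose (n + 1)) * ((of_nat k + of_nat n * \<beta> - 1) gchoose (n - 1))
    = (\<Sum>j=0..n. int_gbinomial (of_nat n * (2 - \<beta>)) (int j - 1)
         * int_gbinomial (of_nat n * \<beta>) (int n - int j)
         * (if k < j then 0 else of_nat ((2 * n + (k - j)) choose (k - j))))"
    (is "_ = (\<Sum>j=0..n. ?t j)")
proof -
  define x :: complex where "x = of_nat (k + n)"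
  define y where "y = of_nat k + of_nat n * \<beta> - 1"
  \<comment> \<open>With this \<open>x\<close> and \<open>y\<close>, \<open>k\<close> cancels from
    both weights of Nanjundiah's identity, so they can serve as coefficients of a fixed
    polynomial.\<close>
  have a: "of_nat (n + 1) - x + y = of_nat n * \<beta>"
    by (simp add: x_def y_def)
  have b: "of_nat (n - 1) + x - y = of_nat n * (2 - \<beta>)"
    using assms by (simp add: x_def y_def of_nat_diff algebra_simps)
  have "(x gchoose (n + 1)) * (y gchoose (n - 1))
      = (\<Sum>i=0..n - 1. ((of_nat n * \<beta>) gchoose i) * ((of_nat n * (2 - \<beta>)) gchoose (n - 1 - i))
          * ((x + of_nat i) gchoose (n + 1 + (n - 1))))"
    using gbinomial_Nanjundiah[where m = "n + 1" and n = "n - 1" and x = x and y = y]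
    by (simp only: a b)
  also have "\<dots> = (\<Sum>j=1..n. ?t j)"
  proof (rule sum.reindex_bij_witness[of _ "\<lambda>j. n - j" "\<lambda>i. n - i"])
    fix i assume "i \<in> {0..n - 1}"
    then have i: "i < n" using assms by auto
    have "((x + of_nat i) gchoose (n + 1 + (n - 1))) = of_nat ((k + n + i) choose (2 * n))"
      using assms by (simp add: x_def binomial_gbinomial mult_2)
    \<comment> \<open>With \<open>j = n - i\<close> the upper index is \<open>2 * n + k - j\<close>.
      For \<open>k < j\<close> it lies below \<open>2 * n\<close> and the binomial vanishes; the
      case split keeps natural subtraction from hiding this.\<close>
    also have "\<dots> = (if k < n - i then 0
        else of_nat ((2 * n + (k - (n - i))) choose (k - (n - i))))"
    proof (cases "k < n - i")
      case False
      then have e: "k + n + i = 2 * n + (k - (n - i))" using i by linarith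
      have "(2 * n + l) choose (2 * n) = (2 * n + l) choose l" for l
        by (subst binomial_symmetric) auto
      then show ?thesis
        unfolding e using False by (simp only: if_False)
    qed (simp add: binomial_eq_0)
    finally show "?t (n - i) = ((of_nat n * \<beta>) gchoose i)
        * ((of_nat n * (2 - \<beta>)) gchoose (n - 1 - i)) * ((x + of_nat i) gchoose (n + 1 + (n - 1)))"
      using i by (simp add: int_gbinomial_def of_nat_diff nat_diff_distrib)
  qed (use assms in auto)
  \<comment> \<open>The added term \<open>j = 0\<close> has lower index -1, where
    \<open>int_gbinomial\<close> is 0.\<close>
  also have "\<dots> = (\<Sum>j=0..n. ?t j)"
    by (simp add: sum.atLeast_Suc_atMost[of 0] int_gbinomial_def)
  finally show ?thesis
    by (simp add: x_def y_def)
qed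

theorem theorem4p5:
  fixes \<beta> :: complex and n :: nat
  assumes "n \<ge> 1"
  shows "gbs_phi \<beta> n =
    fps_const (fact (n + 1) / of_nat n) *
    (\<Sum>m = 0..n. fps_const (int_gbinomial (of_nat n * (2 - \<beta>)) (int m - 1) *
                            int_gbinomial (of_nat n * \<beta>) (int n - int m)) * fps_X ^ m)"
    (is "_ = ?R")
proof -
  \<comment> \<open>This is the expansion of 1/(1-x)^(2n+1). It suffices to show that the diagonal
    series is \<open>?R * A\<close>.\<close>
  define A :: "complex fps" where "A = Abs_fps (\<lambda>k. of_nat ((2 * n + k) choose k))"
  have A: "(1 - fps_X) ^ (2 * n + 1) * A = 1"
    using one_minus_const_fps_X_neg_power'[of "2 * n + 1" "1 :: complex"]
      inverse_mult_eq_1'[of "(1 - fps_X :: complex fps) ^ (2 * n + 1)"]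
    by (simp add: A_def fps_power_zeroth del: power_Suc)
  have "Abs_fps (\<lambda>m. pochhammer (of_nat (m + 1)) n * gbs_coeff \<beta> n m) = ?R * A"
  proof (rule fps_ext)
    fix k
    \<comment> \<open>Multiplication by \<open>fps_X ^ j\<close> shifts \<open>A\<close> by
      \<open>j\<close>, which produces exactly the conditional factor of
      \<open>diagonal_coeff_expansion\<close>.\<close>
    have "fps_nth (fps_const c * fps_X ^ j * A) k
        = c * (if k < j then 0 else of_nat ((2 * n + (k - j)) choose (k - j)))" for c j
      by (simp add: A_def mult.assoc fps_X_power_mult_nth)
    then have "fps_nth (?R * A) k = fact (n + 1) / of_nat n
        * ((of_nat (k + n) gchoose (n + 1)) * ((of_nat k + of_nat n * \<beta> - 1) gchoose (n - 1)))"
      unfolding diagonal_coeff_expansion[OF assms] mult.assoc[of "fps_const (fact (n + 1) / of_nat n)"]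
        sum_distrib_right fps_mult_left_const_nth fps_sum_nth by simp
    then show "fps_nth (Abs_fps (\<lambda>m. pochhammer (of_nat (m + 1)) n * gbs_coeff \<beta> n m)) k
        = fps_nth (?R * A) k"
      by (simp only: fps_nth_Abs_fps diagonal_coeff[OF assms])
  qed
  then have "gbs_phi \<beta> n = ?R * ((1 - fps_X) ^ (2 * n + 1) * A)"
    by (simp only: gbs_phi_def mult_ac)
  then show ?thesis
    by (simp only: A mult_1_right)
qed

end
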